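(* Let $n\geq 4$ be an integer and let $(C_n,\mathcal{C}_n)$ be the semi-coarse space induced by the $n$-cycle graph. Then $\pi_1^{sc}(C_n,\mathcal{C}_n)\cong\mathbb{Z}$.
   Context: A semi-coarse structure on a set $X$ is a collection $\mathcal{V}$ of subsets of $X\times X$ containing the diagonal $\Delta_X$ and closed under subsets, finite unions and inverses $V\mapsto V^{-1}=\{(y,x):(x,y)\in V\}$; $(X,\mathcal V)$ is a semi-coarse space. A map $f:(X,\mathcal{V})\to(Y,\mathcal{W})$ is bornologous if $(f\times f)(V)\in\mathcal{W}$ for all $V\in\mathcal{V}$. The product structure $\mathcal{V}\times\mathcal{W}$ on $X\times Y$ consists of all subsets of finite unions of sets $V\boxtimes W=\{((a,b),(c,d)):(a,c)\in V,(b,d)\in W\}$ with $V\in\mathcal{V}$, $W\in\mathcal{W}$. The $n$-cycle: $C_n=\{0,1,\dots,n-1\}$ with edges joining $k$ to $k\pm1$ modulo $n$. The induced semi-coarse structure $\mathcal{C}_n$ is the power set of $\{(k,l)\in C_n\times C_n: l\equiv k-1,\ k,\ \text{or } k+1 \pmod n\}$. The base point is $0$. $\mathbb{Z}$ carries the structure $\mathcal{Z}$ of all subsets of $\{(a,b)\in\mathbb{Z}^2:|a-b|\leq 1\}$; for an integer $m\ge1$, $I_m=\{0,\dots,m\}$ has the structure of all subsets of $\{(a,b)\in I_m^2:|a-b|\le1\}$. For a semi-coarse space $(X,\mathcal V)$ with base point $*$, consider bornologous maps $f:I_m\to X$ with $f(0)=f(m)=*$. Two such maps $f,g$ are homotopic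 if there are a bornologous $H:I_m\times\mathbb{Z}\to X$ (product structure on the source) and integers $M<N$ with $H(x,k)=f(x)$ for $k\le M$, $H(x,k)=g(x)$ for $k\ge N$, and $H(0,k)=H(m,k)=*$ for all $k$. For $m<m'$, precomposition with $\phi_m^{m'}:I_{m'}\to I_m$, $x\mapsto\min(x,m)$, induces maps between the sets of homotopy classes; $\pi_1^{sc}(X,* )$ is the direct limit over $m$ of these sets, and $\langle f\rangle$ denotes the class of $f$. It is a group under $\langle f\rangle\star\langle g\rangle=\langle f\star g\rangle$, where for $f:I_m\to X$, $g:I_{m'}\to X$ the map $f\star g:I_{m+m'}\to X$ is $f(\alpha)$ for $0\le\alpha\le m$ and $g(\alpha-m)$ for $m<\alpha\le m+m'$. The isomorphism in the claim is an isomorphism of groups. *)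

theory Defs
  imports "HOL-Algebra.Elementary_Groups" "HOL-Number_Theory.Cong"
begin

section \<open>Semi-coarse spaces\<close>

locale semi_coarse_space =
  fixes X :: "'a set" and \<V> :: "('a \<times> 'a) set set"
  assumes subset_carrier: "V \<in> \<V> \<Longrightarrow> V \<subseteq> X \<times> X"
    and diagonal: "Id_on X \<in> \<V>"
    and subset_closed: "V \<in> \<V> \<Longrightarrow> U \<subseteq> V \<Longrightarrow> U \<in> \<V>"
    and Un_closed: "U \<in> \<V> \<Longrightarrow> V \<in> \<V> \<Longrightarrow> U \<union> V \<in> \<V>"
    and converse_closed: "V \<in> \<V> \<Longrightarrow> V\<inverse> \<in> \<V>"

definition bornologous ::
  "'a set \<Rightarrow> ('a \<times> 'a) set set \<Rightarrow> 'b set \<Rightarrow> ('b \<times> 'b) set set \<Rightarrow> ('a \<Rightarrow> 'b) \<Rightarrow> bool" where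
  "bornologous X \<V> Y \<W> f \<longleftrightarrow> f \<in> X \<rightarrow> Y \<and> (\<forall>V\<in>\<V>. map_prod f f ` V \<in> \<W>)"

definition box_rel :: "('a \<times> 'a) set \<Rightarrow> ('b \<times> 'b) set \<Rightarrow> (('a \<times> 'b) \<times> ('a \<times> 'b)) set" where
  "box_rel V W = {((a, b), (c, d)) | a b c d. (a, c) \<in> V \<and> (b, d) \<in> W}"

definition prod_structure ::
  "('a \<times> 'a) set set \<Rightarrow> ('b \<times> 'b) set set \<Rightarrow> (('a \<times> 'b) \<times> ('a \<times> 'b)) set set" where
  "prod_structure \<V> \<W> =
     {E. \<exists>F. finite F \<and> F \<subseteq> {box_rel V W | V W. V \<in> \<V> \<and> W \<in> \<W>} \<and> E \<subseteq> \<Union>F}"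

definition cycle_set :: "int \<Rightarrow> int set" where
  "cycle_set n = {0..<n}"

definition cycle_structure :: "int \<Rightarrow> (int \<times> int) set set" where
  "cycle_structure n =
     Pow {(k, l). k \<in> cycle_set n \<and> l \<in> cycle_set n \<and>
            ([l = k - 1] (mod n) \<or> [l = k] (mod n) \<or> [l = k + 1] (mod n))}"

definition line_structure :: "(int \<times> int) set set" where
  "line_structure = Pow {(a, b). \<bar>a - b\<bar> \<le> 1}"

definition interval_structure :: "int \<Rightarrow> (int \<times> int) set set" where
  "interval_structure m = Pow {(a, b). a \<in> {0..m} \<and> b \<in> {0..m} \<and> \<bar>a - b\<bar> \<le> 1}"


section \<open>Loops and homotopy\<close>

text \<open>Maps on the interval \<open>{0..m}\<close> are represented by functions that are extensional on it, so that
  equality of maps is equality of functions.\<close>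

definition loops :: "'a set \<Rightarrow> ('a \<times> 'a) set set \<Rightarrow> 'a \<Rightarrow> int \<Rightarrow> (int \<Rightarrow> 'a) set" where
  "loops X \<V> p m =
     {f \<in> extensional {0..m}.
        bornologous {0..m} (interval_structure m) X \<V> f \<and> f 0 = p \<and> f m = p}"

definition homotopy ::
  "'a set \<Rightarrow> ('a \<times> 'a) set set \<Rightarrow> 'a \<Rightarrow> int \<Rightarrow> ((int \<Rightarrow> 'a) \<times> (int \<Rightarrow> 'a)) set" where
  "homotopy X \<V> p m =
     {(f, g). f \<in> loops X \<V> p m \<and> g \<in> loops X \<V> p m \<and>
        (\<exists>H M N. M < N \<and>
           bornologous ({0..m} \<times> (UNIV :: int set))
             (prod_structure (interval_structure m) line_structure) X \<V> H \<and>
           (\<forall>x\<in>{0..m}. \<forall>k\<le>M. H (x, k) = f x) \<and>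
           (\<forall>x\<in>{0..m}. \<forall>k\<ge>N. H (x, k) = g x) \<and>
           (\<forall>k. H (0, k) = p \<and> H (m, k) = p))}"

definition homotopy_classes ::
  "'a set \<Rightarrow> ('a \<times> 'a) set set \<Rightarrow> 'a \<Rightarrow> int \<Rightarrow> (int \<Rightarrow> 'a) set set" where
  "homotopy_classes X \<V> p m = loops X \<V> p m // homotopy X \<V> p m"


section \<open>The fundamental group\<close>

definition pad :: "int \<Rightarrow> int \<Rightarrow> (int \<Rightarrow> 'a) \<Rightarrow> int \<Rightarrow> 'a" where
  "pad m m' f = (\<lambda>x\<in>{0..m'}. f (min x m))"

text \<open>The induced map on homotopy classes is written as the saturation of the image of a class, which
  is the class of \<open>pad m m' f\<close> for any representative \<open>f\<close>.\<close>

definition transition ::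
  "'a set \<Rightarrow> ('a \<times> 'a) set set \<Rightarrow> 'a \<Rightarrow> int \<Rightarrow> int \<Rightarrow> (int \<Rightarrow> 'a) set \<Rightarrow> (int \<Rightarrow> 'a) set" where
  "transition X \<V> p m m' c = homotopy X \<V> p m' `` (pad m m' ` c)"

text \<open>The direct limit is the quotient of the disjoint union of the sets of homotopy classes by
  eventual equality.\<close>

definition limit_base ::
  "'a set \<Rightarrow> ('a \<times> 'a) set set \<Rightarrow> 'a \<Rightarrow> (int \<times> (int \<Rightarrow> 'a) set) set" where
  "limit_base X \<V> p = (SIGMA m:{1..}. homotopy_classes X \<V> p m)"

definition limit_rel ::
  "'a set \<Rightarrow> ('a \<times> 'a) set set \<Rightarrow> 'a
     \<Rightarrow> ((int \<times> (int \<Rightarrow> 'a) set) \<times> (int \<times> (int \<Rightarrow> 'a) set)) set" where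
  "limit_rel X \<V> p =
     {((m, c), (m', c')). (m, c) \<in> limit_base X \<V> p \<and> (m', c') \<in> limit_base X \<V> p \<and>
        (\<exists>k. m \<le> k \<and> m' \<le> k \<and> transition X \<V> p m k c = transition X \<V> p m' k c')}"

definition loop_class ::
  "'a set \<Rightarrow> ('a \<times> 'a) set set \<Rightarrow> 'a \<Rightarrow> int \<Rightarrow> (int \<Rightarrow> 'a) \<Rightarrow> (int \<times> (int \<Rightarrow> 'a) set) set" where
  "loop_class X \<V> p m f = limit_rel X \<V> p `` {(m, homotopy X \<V> p m `` {f})}"

definition loop_concat :: "int \<Rightarrow> int \<Rightarrow> (int \<Rightarrow> 'a) \<Rightarrow> (int \<Rightarrow> 'a) \<Rightarrow> int \<Rightarrow> 'a" where
  "loop_concat m m' f g = (\<lambda>x\<in>{0..m + m'}. if x \<le> m then f x else g (x - m))"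

definition pi1_mult ::
  "'a set \<Rightarrow> ('a \<times> 'a) set set \<Rightarrow> 'a \<Rightarrow> (int \<times> (int \<Rightarrow> 'a) set) set
     \<Rightarrow> (int \<times> (int \<Rightarrow> 'a) set) set \<Rightarrow> (int \<times> (int \<Rightarrow> 'a) set) set" where
  "pi1_mult X \<V> p a b =
     (THE c. \<exists>m m' f g. m \<ge> 1 \<and> m' \<ge> 1 \<and> f \<in> loops X \<V> p m \<and> g \<in> loops X \<V> p m' \<and>
        a = loop_class X \<V> p m f \<and> b = loop_class X \<V> p m' g \<and>
        c = loop_class X \<V> p (m + m') (loop_concat m m' f g))"

definition pi1_sc ::
  "'a set \<Rightarrow> ('a \<times> 'a) set set \<Rightarrow> 'a \<Rightarrow> (int \<times> (int \<Rightarrow> 'a) set) set monoid" where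
  "pi1_sc X \<V> p =
     \<lparr>carrier = limit_base X \<V> p // limit_rel X \<V> p,
      monoid.mult = pi1_mult X \<V> p,
      one = loop_class X \<V> p 1 (\<lambda>x\<in>{0..1}. p)\<rparr>"


section \<open>The structures above are semi-coarse\<close>

lemma semi_coarse_space_Pow:
  assumes "R \<subseteq> X \<times> X" "Id_on X \<subseteq> R" "sym R"
  shows "semi_coarse_space X (Pow R)"
proof
  fix V assume "V \<in> Pow R"
  then have "V\<inverse> \<subseteq> R\<inverse>" by blast
  with assms(3) show "V\<inverse> \<in> Pow R" by (simp add: sym_conv_converse_eq)
qed (use assms in blast)+

lemma semi_coarse_space_cycle: "semi_coarse_space (cycle_set n) (cycle_structure n)"
  unfolding cycle_structure_def
proof (rule semi_coarse_space_Pow)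
  have "[k = l - 1] (mod n)" if "[l = k + 1] (mod n)" for k l
    using cong_diff[OF that cong_refl[of 1]] by (simp add: cong_sym)
  moreover have "[k = l + 1] (mod n)" if "[l = k - 1] (mod n)" for k l
    using cong_add[OF that cong_refl[of 1]] by (simp add: cong_sym)
  ultimately show "sym {(k, l). k \<in> cycle_set n \<and> l \<in> cycle_set n \<and>
      ([l = k - 1] (mod n) \<or> [l = k] (mod n) \<or> [l = k + 1] (mod n))}"
    unfolding sym_def using cong_sym by blast
qed auto

lemma semi_coarse_space_line: "semi_coarse_space UNIV line_structure"
  unfolding line_structure_def by (rule semi_coarse_space_Pow) (auto simp: sym_def)

lemma semi_coarse_space_interval: "semi_coarse_space {0..m} (interval_structure m)"
  unfolding interval_structure_def by (rule semi_coarse_space_Pow) (auto simp: sym_def)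

lemma semi_coarse_space_prod:
  assumes "semi_coarse_space X \<V>" "semi_coarse_space Y \<W>"
  shows "semi_coarse_space (X \<times> Y) (prod_structure \<V> \<W>)"
proof -
  interpret X: semi_coarse_space X \<V> by fact
  interpret Y: semi_coarse_space Y \<W> by fact
  define B where "B = {box_rel V W | V W. V \<in> \<V> \<and> W \<in> \<W>}"
  have in_prod: "E \<in> prod_structure \<V> \<W> \<longleftrightarrow> (\<exists>F. finite F \<and> F \<subseteq> B \<and> E \<subseteq> \<Union>F)" for E
    by (simp add: prod_structure_def B_def)
  have B_sub: "D \<subseteq> (X \<times> Y) \<times> (X \<times> Y)" if D: "D \<in> B" for D
  proof -
    obtain V W where "D = box_rel V W" "V \<in> \<V>" "W \<in> \<W>"
      using D unfolding B_def by blast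
    then show ?thesis
      using X.subset_carrier[of V] Y.subset_carrier[of W] by (auto simp: box_rel_def)
  qed
  have B_conv: "D\<inverse> \<in> B" if D: "D \<in> B" for D
  proof -
    obtain V W where D: "D = box_rel V W" "V \<in> \<V>" "W \<in> \<W>"
      using D unfolding B_def by blast
    have "D\<inverse> = box_rel (V\<inverse>) (W\<inverse>)"
      unfolding D(1) box_rel_def by auto
    then show ?thesis
      unfolding B_def using X.converse_closed[OF D(2)] Y.converse_closed[OF D(3)] by blast
  qed
  show ?thesis
  proof
    fix E assume "E \<in> prod_structure \<V> \<W>"
    then obtain F where "F \<subseteq> B" "E \<subseteq> \<Union>F" unfolding in_prod by blast
    with B_sub show "E \<subseteq> (X \<times> Y) \<times> (X \<times> Y)" by (meson Sup_least order_trans subsetD)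
  next
    have "box_rel (Id_on X) (Id_on Y) \<in> B"
      unfolding B_def using X.diagonal Y.diagonal by blast
    moreover have "Id_on (X \<times> Y) \<subseteq> box_rel (Id_on X) (Id_on Y)" by (auto simp: box_rel_def)
    ultimately show "Id_on (X \<times> Y) \<in> prod_structure \<V> \<W>"
      unfolding in_prod by (intro exI[of _ "{box_rel (Id_on X) (Id_on Y)}"]) simp
  next
    fix E D assume "E \<in> prod_structure \<V> \<W>" "D \<subseteq> E"
    then show "D \<in> prod_structure \<V> \<W>" unfolding in_prod by (meson order_trans)
  next
    fix D E assume "D \<in> prod_structure \<V> \<W>" "E \<in> prod_structure \<V> \<W>"
    then obtain F G where "finite F" "F \<subseteq> B" "D \<subseteq> \<Union>F" "finite G" "G \<subseteq> B" "E \<subseteq> \<Union>G"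
      unfolding in_prod by blast
    then have "finite (F \<union> G) \<and> F \<union> G \<subseteq> B \<and> D \<union> E \<subseteq> \<Union>(F \<union> G)" by auto
    then show "D \<union> E \<in> prod_structure \<V> \<W>" unfolding in_prod by (rule exI)
  next
    fix E assume "E \<in> prod_structure \<V> \<W>"
    then obtain F where F: "finite F" "F \<subseteq> B" "E \<subseteq> \<Union>F"
      unfolding in_prod by blast
    have "finite (converse ` F)" using F(1) by simp
    moreover have "converse ` F \<subseteq> B" using F(2) B_conv by auto
    moreover have "E\<inverse> \<subseteq> \<Union>(converse ` F)" using F(3) by auto
    ultimately show "E\<inverse> \<in> prod_structure \<V> \<W>" unfolding in_prod by blast
  qed
qed

end

theory Submission
  imports Defs
begin

text \<open>A loop in the cycle lifts uniquely to an integer path starting at \<open>0\<close> with steps in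
  \<open>{-1, 0, 1}\<close>, and its winding number is the end point of the lift divided by \<open>n\<close>. The four corners
  of a unit square of \<open>I\<^sub>m \<times> \<int>\<close> are pairwise adjacent, so a homotopy maps them to pairwise adjacent
  vertices; for \<open>n \<ge> 4\<close> there are no triangles in the cycle, steps add up along such vertices, and
  the winding number is a homotopy invariant. Conversely, maxima and minima of integers are
  nonexpansive for the supremum norm, so two lifts \<open>F\<close> and \<open>G\<close> with the same end point are joined by
  the homotopy \<open>max (min F (3B - k)) (min G k)\<close>, with \<open>k\<close> the time and \<open>B\<close> a common bound. The winding
  number is therefore a complete invariant already on each \<open>I\<^sub>m\<close>; it is invariant under padding,
  additive under concatenation and onto the integers.\<close>

section \<open>Bornologous maps between relations\<close>

lemma bornologous_Pow:
  "bornologous X (Pow R) Y (Pow S) f \<longleftrightarrow> f \<in> X \<rightarrow> Y \<and> (\<forall>(a, b)\<in>R. (f a, f b) \<in> S)"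
  unfolding bornologous_def by (fastforce simp: image_subset_iff)

text \<open>Each box of subsets of \<open>R\<close> and \<open>S\<close> lies in the single box
  \<open>box_rel R S\<close>, so finite unions of boxes collapse to subsets of that one.\<close>

lemma prod_structure_Pow: "prod_structure (Pow R) (Pow S) = Pow (box_rel R S)"
proof (intro equalityI subsetI)
  fix E assume "E \<in> prod_structure (Pow R) (Pow S)"
  then obtain F where F: "F \<subseteq> {box_rel V W | V W. V \<in> Pow R \<and> W \<in> Pow S}" "E \<subseteq> \<Union>F"
    unfolding prod_structure_def by blast
  have "D \<subseteq> box_rel R S" if "D \<in> F" for D
    using F(1) that by (fastforce simp: box_rel_def)
  with F(2) show "E \<in> Pow (box_rel R S)" by blast
next
  fix E assume "E \<in> Pow (box_rel R S)"
  then show "E \<in> prod_structure (Pow R) (Pow S)"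
    unfolding prod_structure_def by (intro CollectI exI[of _ "{box_rel R S}"]) blast
qed


section \<open>Fundamental groups classified by an integer invariant\<close>

text \<open>Separates the direct limit and the group law from the geometry of the space: a complete
  homotopy invariant on each interval, compatible with padding and concatenation, determines the
  group. In \<open>surj\<close> the length may depend on \<open>d\<close>, since an interval of
  fixed length need not carry loops of every value.\<close>

locale winding_number =
  fixes X :: "'a set" and \<V> :: "('a \<times> 'a) set set" and p :: 'a
    and w :: "int \<Rightarrow> (int \<Rightarrow> 'a) \<Rightarrow> int"
  assumes homotopy_iff: "m \<ge> 1 \<Longrightarrow> (f, g) \<in> homotopy X \<V> p m \<longleftrightarrow>
      f \<in> loops X \<V> p m \<and> g \<in> loops X \<V> p m \<and> w m f = w m g"
    and pad_loop: "1 \<le> m \<Longrightarrow> m \<le> m' \<Longrightarrow> f \<in> loops X \<V> p m \<Longrightarrow>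
      pad m m' f \<in> loops X \<V> p m' \<and> w m' (pad m m' f) = w m f"
    and concat_loop: "1 \<le> m \<Longrightarrow> 1 \<le> m' \<Longrightarrow> f \<in> loops X \<V> p m \<Longrightarrow> g \<in> loops X \<V> p m' \<Longrightarrow>
      loop_concat m m' f g \<in> loops X \<V> p (m + m') \<and>
      w (m + m') (loop_concat m m' f g) = w m f + w m' g"
    and const_loop: "(\<lambda>x\<in>{0..1}. p) \<in> loops X \<V> p 1 \<and> w 1 (\<lambda>x\<in>{0..1}. p) = 0"
    and surj: "\<exists>m f. 1 \<le> m \<and> f \<in> loops X \<V> p m \<and> w m f = d"
begin

section \<open>Homotopy classes and their direct limit as level sets\<close>

definition level :: "int \<Rightarrow> int \<Rightarrow> (int \<Rightarrow> 'a) set" where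
  "level m d = {g \<in> loops X \<V> p m. w m g = d}"

text \<open>The intended element of the direct limit with value \<open>d\<close>. Empty level sets
  are left out because a homotopy class is never empty.\<close>

definition winding_class :: "int \<Rightarrow> (int \<times> (int \<Rightarrow> 'a) set) set" where
  "winding_class d = {(m, level m d) | m. 1 \<le> m \<and> level m d \<noteq> {}}"

lemma homotopy_class: "1 \<le> m \<Longrightarrow> f \<in> loops X \<V> p m \<Longrightarrow> homotopy X \<V> p m `` {f} = level m (w m f)"
  by (auto simp: homotopy_iff level_def)

lemma mem_limit_base:
  "(m, c) \<in> limit_base X \<V> p \<longleftrightarrow> 1 \<le> m \<and> (\<exists>d. c = level m d \<and> level m d \<noteq> {})"
proof -
  have "homotopy_classes X \<V> p m = {level m d | d. level m d \<noteq> {}}" if m: "1 \<le> m"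
  proof (intro equalityI subsetI)
    fix c assume "c \<in> homotopy_classes X \<V> p m"
    then obtain f where f: "f \<in> loops X \<V> p m" "c = homotopy X \<V> p m `` {f}"
      unfolding homotopy_classes_def by (rule quotientE)
    then have "c = level m (w m f)" "f \<in> level m (w m f)"
      using homotopy_class[OF m] by (auto simp: level_def)
    then show "c \<in> {level m d | d. level m d \<noteq> {}}" by blast
  next
    fix c assume "c \<in> {level m d | d. level m d \<noteq> {}}"
    then obtain d f where c: "c = level m d" and f: "f \<in> level m d" by blast
    then have "f \<in> loops X \<V> p m" "c = homotopy X \<V> p m `` {f}"
      using homotopy_class[OF m] by (auto simp: level_def)
    then show "c \<in> homotopy_classes X \<V> p m"
      unfolding homotopy_classes_def by (simp add: quotientI)
  qed
  then show ?thesis unfolding limit_base_def by auto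
qed

lemma level_inj: "level m d = level m d' \<Longrightarrow> level m d \<noteq> {} \<Longrightarrow> d = d'"
  unfolding level_def by blast

lemma transition_level:
  assumes "1 \<le> m" "m \<le> k" "level m d \<noteq> {}"
  shows "transition X \<V> p m k (level m d) = level k d" "level k d \<noteq> {}"
proof -
  have pad: "pad m k f \<in> level k d" if "f \<in> level m d" for f
    using pad_loop[OF assms(1,2), of f] that by (simp add: level_def)
  with assms(3) show "level k d \<noteq> {}" by blast
  have "homotopy X \<V> p k `` {pad m k f} = level k d" if "f \<in> level m d" for f
    using homotopy_class[of k "pad m k f"] pad[OF that] assms by (simp add: level_def)
  then show "transition X \<V> p m k (level m d) = level k d"
    unfolding transition_def using assms(3) by blast
qed

text \<open>Padding preserves the invariant and the longer of two intervals is a common stage, so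
  eventual equality is equality of values. The quotient can then be computed from images of single
  elements.\<close>

lemma limit_rel_iff:
  assumes "1 \<le> m" "level m d \<noteq> {}"
  shows "((m, level m d), b) \<in> limit_rel X \<V> p \<longleftrightarrow> b \<in> winding_class d"
proof -
  obtain m' c' where b: "b = (m', c')" by force
  show ?thesis
  proof
    assume "((m, level m d), b) \<in> limit_rel X \<V> p"
    then obtain d' k where "1 \<le> m'" "c' = level m' d'" "level m' d' \<noteq> {}" "m \<le> k" "m' \<le> k"
      "transition X \<V> p m k (level m d) = transition X \<V> p m' k (level m' d')"
      unfolding limit_rel_def b by (auto simp: mem_limit_base)
    \<comment> \<open>At stage \<open>k\<close> the two classes become the level sets of
      \<open>d\<close> and \<open>d'\<close>, and a nonempty level set determines its value.\<close>
    moreover from this have "d = d'"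
      using transition_level[OF assms(1), of k d] transition_level[of m' k d'] assms(2) level_inj
      by metis
    ultimately show "b \<in> winding_class d" unfolding b winding_class_def by blast
  next
    assume "b \<in> winding_class d"
    then have m': "1 \<le> m'" "c' = level m' d" "level m' d \<noteq> {}"
      unfolding b winding_class_def by auto
    define k where "k = max m m'"
    have k: "m \<le> k" "m' \<le> k" unfolding k_def by auto
    have "transition X \<V> p m k (level m d) = transition X \<V> p m' k (level m' d)"
      using transition_level(1)[of _ k] assms m' k by simp
    with k show "((m, level m d), b) \<in> limit_rel X \<V> p"
      using assms m' unfolding limit_rel_def b by (auto simp: mem_limit_base)
  qed
qed

lemma loop_class_eq:
  assumes "1 \<le> m" "f \<in> loops X \<V> p m"
  shows "loop_class X \<V> p m f = winding_class (w m f)"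
proof -
  have "level m (w m f) \<noteq> {}" using assms by (auto simp: level_def)
  then show ?thesis
    unfolding loop_class_def homotopy_class[OF assms] using limit_rel_iff[OF assms(1)] by blast
qed

lemma winding_class_cases:
  obtains m f where "1 \<le> m" "f \<in> loops X \<V> p m" "w m f = d" "winding_class d = loop_class X \<V> p m f"
  using surj[of d] loop_class_eq by metis

lemma inj_winding_class: "inj winding_class"
proof (rule injI)
  fix d d' assume eq: "winding_class d = winding_class d'"
  obtain m f where "1 \<le> m" "f \<in> loops X \<V> p m" "w m f = d" using surj by blast
  then have "level m d \<noteq> {}" "(m, level m d) \<in> winding_class d"
    by (auto simp: level_def winding_class_def)
  then show "d = d'"
    unfolding eq by (auto simp: winding_class_def dest: level_inj)
qed

section \<open>The group and its isomorphism with the integers\<close>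

lemma carrier_pi1: "carrier (pi1_sc X \<V> p) = range winding_class"
proof -
  have "limit_base X \<V> p // limit_rel X \<V> p = range winding_class"
  proof (intro equalityI subsetI)
    fix a assume "a \<in> limit_base X \<V> p // limit_rel X \<V> p"
    then obtain m c where mc: "(m, c) \<in> limit_base X \<V> p" "a = limit_rel X \<V> p `` {(m, c)}"
      by (auto elim: quotientE)
    then obtain d where "1 \<le> m" "c = level m d" "level m d \<noteq> {}"
      by (auto simp: mem_limit_base)
    then have "a = winding_class d" using mc(2) limit_rel_iff by blast
    then show "a \<in> range winding_class" by blast
  next
    fix a assume "a \<in> range winding_class"
    then obtain d where a: "a = winding_class d" by blast
    obtain m f where m: "1 \<le> m" "f \<in> loops X \<V> p m" "w m f = d" using surj by blast
    then have ne: "level m d \<noteq> {}" by (auto simp: level_def)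
    with m have "(m, level m d) \<in> limit_base X \<V> p" by (auto simp: mem_limit_base)
    moreover have "a = limit_rel X \<V> p `` {(m, level m d)}"
      unfolding a using limit_rel_iff[OF m(1) ne] by blast
    ultimately show "a \<in> limit_base X \<V> p // limit_rel X \<V> p" by (simp add: quotientI)
  qed
  then show ?thesis by (simp add: pi1_sc_def)
qed

text \<open>The definite description in \<open>pi1_mult\<close> needs a pair of representatives and
  independence of their choice. The first comes from \<open>surj\<close>; the second holds because
  \<open>inj_winding_class\<close> recovers the values from the classes and concatenation adds
  them.\<close>

lemma mult_pi1:
  "winding_class a \<otimes>\<^bsub>pi1_sc X \<V> p\<^esub> winding_class b = winding_class (a + b)"
proof -
  have "pi1_mult X \<V> p (winding_class a) (winding_class b) = winding_class (a + b)"
    unfolding pi1_mult_def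
  proof (rule the_equality)
    obtain m f where f: "1 \<le> m" "f \<in> loops X \<V> p m" "w m f = a"
      "winding_class a = loop_class X \<V> p m f"
      by (rule winding_class_cases)
    obtain m' g where g: "1 \<le> m'" "g \<in> loops X \<V> p m'" "w m' g = b"
      "winding_class b = loop_class X \<V> p m' g"
      by (rule winding_class_cases)
    have "winding_class (a + b) = loop_class X \<V> p (m + m') (loop_concat m m' f g)"
      using concat_loop[OF f(1) g(1) f(2) g(2)] f g by (simp add: loop_class_eq)
    with f g show "\<exists>m m' f g. m \<ge> 1 \<and> m' \<ge> 1 \<and> f \<in> loops X \<V> p m \<and> g \<in> loops X \<V> p m' \<and>
        winding_class a = loop_class X \<V> p m f \<and> winding_class b = loop_class X \<V> p m' g \<and>
        winding_class (a + b) = loop_class X \<V> p (m + m') (loop_concat m m' f g)"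
      by blast
  next
    fix c
    assume "\<exists>m m' f g. m \<ge> 1 \<and> m' \<ge> 1 \<and> f \<in> loops X \<V> p m \<and> g \<in> loops X \<V> p m' \<and>
        winding_class a = loop_class X \<V> p m f \<and> winding_class b = loop_class X \<V> p m' g \<and>
        c = loop_class X \<V> p (m + m') (loop_concat m m' f g)"
    then obtain m m' f g where fg: "1 \<le> m" "1 \<le> m'" "f \<in> loops X \<V> p m" "g \<in> loops X \<V> p m'"
      and "winding_class a = loop_class X \<V> p m f" "winding_class b = loop_class X \<V> p m' g"
      and c: "c = loop_class X \<V> p (m + m') (loop_concat m m' f g)"
      by blast
    then have "a = w m f" "b = w m' g"
      by (simp_all add: loop_class_eq inj_eq[OF inj_winding_class])
    then show "c = winding_class (a + b)"
      using concat_loop[OF fg] fg c by (simp add: loop_class_eq)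
  qed
  then show ?thesis by (simp add: pi1_sc_def)
qed

lemma one_pi1: "\<one>\<^bsub>pi1_sc X \<V> p\<^esub> = winding_class 0"
  using const_loop by (simp add: pi1_sc_def loop_class_eq)

theorem group_pi1: "group (pi1_sc X \<V> p)"
proof (rule groupI)
  fix a assume "a \<in> carrier (pi1_sc X \<V> p)"
  then obtain d where "a = winding_class d" by (auto simp: carrier_pi1)
  then show "\<exists>b\<in>carrier (pi1_sc X \<V> p). b \<otimes>\<^bsub>pi1_sc X \<V> p\<^esub> a = \<one>\<^bsub>pi1_sc X \<V> p\<^esub>"
    by (intro bexI[of _ "winding_class (- d)"]) (simp_all add: carrier_pi1 one_pi1 mult_pi1)
qed (auto simp: carrier_pi1 one_pi1 mult_pi1 add.assoc)

theorem pi1_iso_integers: "pi1_sc X \<V> p \<cong> integer_group"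
proof -
  have "winding_class \<in> iso integer_group (pi1_sc X \<V> p)"
    by (auto simp: iso_def hom_def bij_betw_def carrier_pi1 mult_pi1 inj_winding_class)
  then have "integer_group \<cong> pi1_sc X \<V> p" by (auto simp: is_iso_def)
  then show ?thesis by (rule group.iso_sym[OF group_integer_group])
qed

end


section \<open>Loops in the cycle and their lifts\<close>

definition cycle_rel :: "int \<Rightarrow> (int \<times> int) set" where
  "cycle_rel n = {(k, l). k \<in> cycle_set n \<and> l \<in> cycle_set n \<and>
     ([l = k - 1] (mod n) \<or> [l = k] (mod n) \<or> [l = k + 1] (mod n))}"

text \<open>The representative of \<open>b - a\<close> modulo \<open>n\<close> in \<open>{-1..<n - 1}\<close>, so the signed step from \<open>a\<close> to \<open>b\<close>
  whenever these are adjacent.\<close>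

definition cycle_step :: "int \<Rightarrow> int \<Rightarrow> int \<Rightarrow> int" where
  "cycle_step n a b = (b - a + 1) mod n - 1"

text \<open>For a loop the steps sum to a multiple of \<open>n\<close>, so the division is
  exact.\<close>

definition winding :: "int \<Rightarrow> int \<Rightarrow> (int \<Rightarrow> int) \<Rightarrow> int" where
  "winding n m f = (\<Sum>i\<in>{0..<m}. cycle_step n (f i) (f (i + 1))) div n"

definition lifts :: "int \<Rightarrow> int \<Rightarrow> (int \<Rightarrow> int) \<Rightarrow> (int \<Rightarrow> int) \<Rightarrow> bool" where
  "lifts n m f F \<longleftrightarrow> F 0 = 0 \<and> (\<forall>x\<in>{0..m}. f x = F x mod n) \<and>
     (\<forall>x\<in>{0..<m}. \<bar>F (x + 1) - F x\<bar> \<le> 1)"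

lemma cycle_rel_memD: "(a, b) \<in> cycle_rel n \<Longrightarrow> a \<in> cycle_set n"
  by (simp add: cycle_rel_def)

lemma cycle_step_cong: "[cycle_step n a b = b - a] (mod n)"
  unfolding cycle_step_def cong_def by (simp add: mod_diff_left_eq)

text \<open>The shifted difference \<open>v - u + 1\<close> is 0, 1 or 2, hence its own residue once
  \<open>n \<ge> 3\<close>; modulo 2 the steps 1 and -1 would coincide.\<close>

lemma cycle_step_mod:
  assumes "n \<ge> 3" "\<bar>v - u\<bar> \<le> 1"
  shows "cycle_step n (u mod n) (v mod n) = v - u"
proof -
  have "(v mod n - u mod n + 1) mod n = (v - u + 1) mod n"
    by (metis mod_add_left_eq mod_diff_eq)
  also have "\<dots> = v - u + 1" using assms by (intro mod_pos_pos_trivial) auto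
  finally show ?thesis unfolding cycle_step_def by simp
qed

lemma mod_cycle_rel:
  assumes "n \<ge> 3" "\<bar>v - u\<bar> \<le> 1"
  shows "(u mod n, v mod n) \<in> cycle_rel n"
proof -
  have "v = u - 1 \<or> v = u \<or> v = u + 1" using assms by arith
  then show ?thesis
    using assms by (elim disjE) (simp_all add: cycle_rel_def cycle_set_def cong_def mod_simps)
qed

lemma cycle_rel_step:
  assumes "n \<ge> 3" "(a, b) \<in> cycle_rel n"
  shows "\<bar>cycle_step n a b\<bar> \<le> 1"
proof -
  have "\<exists>s\<in>{-1, 0, 1}. [b = a + s] (mod n)"
    using assms(2) unfolding cycle_rel_def by auto
  then obtain s where s: "s \<in> {-1, 0, 1}" "[b = a + s] (mod n)" by blast
  have "a mod n = a" "b mod n = b"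
    using assms(2) by (auto simp: cycle_rel_def cycle_set_def)
  then have "cycle_step n a b = cycle_step n (a mod n) ((a + s) mod n)"
    using s(2) by (simp add: cong_def)
  also have "\<dots> = s" using s(1) assms(1) by (subst cycle_step_mod) auto
  finally show ?thesis using s(1) by auto
qed

text \<open>The differences telescope, so the defect is divisible by \<open>n\<close>; being a
  combination of three steps, it is at most 3 in absolute value. Here \<open>n \<ge> 4\<close> is
  essential: for \<open>n = 3\<close> the vertices 0, 1, 2 have defect 3.\<close>

lemma cycle_step_triangle:
  assumes "n \<ge> 4" "(a, b) \<in> cycle_rel n" "(b, c) \<in> cycle_rel n" "(a, c) \<in> cycle_rel n"
  shows "cycle_step n a b + cycle_step n b c = cycle_step n a c"
proof -
  have "[cycle_step n a b + cycle_step n b c - cycle_step n a c = (b - a) + (c - b) - (c - a)] (mod n)"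
    by (intro cong_add cong_diff cycle_step_cong)
  then have "n dvd cycle_step n a b + cycle_step n b c - cycle_step n a c"
    by (simp add: cong_0_iff)
  moreover have "\<bar>cycle_step n a b + cycle_step n b c - cycle_step n a c\<bar> < n"
    using cycle_rel_step[of n a b] cycle_rel_step[of n b c] cycle_rel_step[of n a c] assms by simp
  ultimately have "cycle_step n a b + cycle_step n b c - cycle_step n a c = 0"
    using dvd_imp_le_int[of "cycle_step n a b + cycle_step n b c - cycle_step n a c" n] assms(1)
    by linarith
  then show ?thesis by simp
qed

section \<open>Lifts as partial sums of steps\<close>

lemma sum_int_Suc: "0 \<le> x \<Longrightarrow> (\<Sum>i\<in>{0..<x + 1}. f i) = (\<Sum>i\<in>{0..<x}. f i) + (f x :: int)" for x :: int
proof -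
  assume "0 \<le> x"
  then have "{0..<x + 1} = insert x {0..<x}" by auto
  then show ?thesis by simp
qed

lemma lifts_lipschitz:
  assumes "lifts n m f F" "a \<in> {0..m}" "b \<in> {0..m}" "\<bar>a - b\<bar> \<le> 1"
  shows "\<bar>F a - F b\<bar> \<le> 1"
proof -
  have step: "\<bar>F (x + 1) - F x\<bar> \<le> 1" if "x \<in> {0..<m}" for x
    using assms(1) that by (simp add: lifts_def)
  consider "a = b + 1" | "a = b" | "b = a + 1" using assms(4) by linarith
  then show ?thesis
  proof cases
    case 1
    then show ?thesis using step[of b] assms(2,3) by simp
  next
    case 3
    then show ?thesis using step[of a] assms(2,3) by simp
  qed simp
qed

text \<open>Uniqueness of lifts: the steps of \<open>f\<close> are the increments of
  \<open>F\<close>, and their sum telescopes from \<open>F 0 = 0\<close>.\<close>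

lemma lifts_sum:
  assumes "n \<ge> 3" "lifts n m f F" "0 \<le> x" "x \<le> m"
  shows "(\<Sum>i\<in>{0..<x}. cycle_step n (f i) (f (i + 1))) = F x"
  using assms(3,4)
proof (induction x rule: int_ge_induct)
  case base
  then show ?case using assms(2) by (simp add: lifts_def)
next
  case (step i)
  have "cycle_step n (f i) (f (i + 1)) = F (i + 1) - F i"
    using assms(1,2) step.hyps step.prems by (simp add: lifts_def cycle_step_mod)
  then show ?case using step by (simp add: sum_int_Suc)
qed

lemma winding_lifts:
  assumes "n \<ge> 3" "lifts n m f F" "0 \<le> m"
  shows "winding n m f = F m div n"
  unfolding winding_def lifts_sum[OF assms order_refl] ..

section \<open>Loops and homotopies as adjacency conditions\<close>

abbreviation cycle_loops :: "int \<Rightarrow> int \<Rightarrow> (int \<Rightarrow> int) set" where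
  "cycle_loops n \<equiv> loops (cycle_set n) (cycle_structure n) 0"

lemma bornologous_cycle_iff:
  "bornologous {0..m} (interval_structure m) (cycle_set n) (cycle_structure n) f \<longleftrightarrow>
     (\<forall>a\<in>{0..m}. \<forall>b\<in>{0..m}. \<bar>a - b\<bar> \<le> 1 \<longrightarrow> (f a, f b) \<in> cycle_rel n)"
  unfolding cycle_structure_def cycle_rel_def[symmetric] interval_structure_def bornologous_Pow
proof -
  have "f \<in> {0..m} \<rightarrow> cycle_set n"
    if "\<forall>a\<in>{0..m}. \<forall>b\<in>{0..m}. \<bar>a - b\<bar> \<le> 1 \<longrightarrow> (f a, f b) \<in> cycle_rel n"
    using that cycle_rel_memD by (metis Pi_I abs_0 diff_self zero_le_one)
  then show "f \<in> {0..m} \<rightarrow> cycle_set n \<and>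
      (\<forall>(a, b)\<in>{(a, b). a \<in> {0..m} \<and> b \<in> {0..m} \<and> \<bar>a - b\<bar> \<le> 1}. (f a, f b) \<in> cycle_rel n) \<longleftrightarrow>
      (\<forall>a\<in>{0..m}. \<forall>b\<in>{0..m}. \<bar>a - b\<bar> \<le> 1 \<longrightarrow> (f a, f b) \<in> cycle_rel n)"
    by blast
qed

text \<open>Space and time may change together, so diagonal neighbours in the grid also have
  adjacent images. The case of equal arguments gives membership in
  \<open>cycle_set n\<close>.\<close>

lemma bornologous_cycle_homotopy_iff:
  "bornologous ({0..m} \<times> (UNIV :: int set)) (prod_structure (interval_structure m) line_structure)
     (cycle_set n) (cycle_structure n) H \<longleftrightarrow>
     (\<forall>a\<in>{0..m}. \<forall>b\<in>{0..m}. \<forall>k l. \<bar>a - b\<bar> \<le> 1 \<longrightarrow> \<bar>k - l\<bar> \<le> 1 \<longrightarrow>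
        (H (a, k), H (b, l)) \<in> cycle_rel n)"
  (is "?L \<longleftrightarrow> ?R")
proof -
  have "?L \<longleftrightarrow> H \<in> {0..m} \<times> UNIV \<rightarrow> cycle_set n \<and> ?R"
    unfolding cycle_structure_def cycle_rel_def[symmetric] interval_structure_def
      line_structure_def prod_structure_Pow bornologous_Pow
    by (fastforce simp: box_rel_def)
  moreover have "H \<in> {0..m} \<times> UNIV \<rightarrow> cycle_set n" if R: ?R
  proof
    fix z assume "z \<in> {0..m} \<times> (UNIV :: int set)"
    then obtain x k where "z = (x, k)" "x \<in> {0..m}" by blast
    then have "(H z, H z) \<in> cycle_rel n" using R by simp
    then show "H z \<in> cycle_set n" by (rule cycle_rel_memD)
  qed
  ultimately show ?thesis by blast
qed

lemma lifts_imp_loop: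
  assumes "n \<ge> 3" "f \<in> extensional {0..m}" "lifts n m f F" "F m mod n = 0" "0 \<le> m"
  shows "f \<in> cycle_loops n m"
proof -
  have "(f a, f b) \<in> cycle_rel n" if "a \<in> {0..m}" "b \<in> {0..m}" "\<bar>a - b\<bar> \<le> 1" for a b
    using mod_cycle_rel[OF assms(1) lifts_lipschitz[OF assms(3)]] assms(3) that
    by (simp add: lifts_def abs_minus_commute)
  moreover have "f 0 = 0" "f m = 0" using assms by (auto simp: lifts_def)
  ultimately show ?thesis
    unfolding loops_def bornologous_cycle_iff using assms(2) by blast
qed

text \<open>Existence of lifts: the partial sums of the signed steps are congruent to
  \<open>f\<close> by telescoping, and \<open>f m = 0\<close> makes the end point a multiple of
  \<open>n\<close>.\<close>

lemma loop_lifts: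
  assumes n: "n \<ge> 3" and m: "0 \<le> m" and f: "f \<in> cycle_loops n m"
  obtains F where "lifts n m f F" "F m = n * winding n m f"
proof -
  define F where "F x = (\<Sum>i\<in>{0..<x}. cycle_step n (f i) (f (i + 1)))" for x :: int
  have adj: "(f a, f b) \<in> cycle_rel n" if "a \<in> {0..m}" "b \<in> {0..m}" "\<bar>a - b\<bar> \<le> 1" for a b
    using f that unfolding loops_def bornologous_cycle_iff by blast
  have ends: "f 0 = 0" "f m = 0" using f by (auto simp: loops_def)
  have small: "f x mod n = f x" if "x \<in> {0..m}" for x
    using adj[OF that that] by (auto simp: cycle_rel_def cycle_set_def)
  have "[F x = f x] (mod n)" if "0 \<le> x" "x \<le> m" for x
    using that
  proof (induction x rule: int_ge_induct)
    case base
    then show ?case using ends by (simp add: F_def)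
  next
    case (step i)
    then have "[F i + cycle_step n (f i) (f (i + 1)) = f i + (f (i + 1) - f i)] (mod n)"
      by (intro cong_add cycle_step_cong) simp
    then show ?case using step by (simp add: F_def sum_int_Suc)
  qed
  then have cong: "F x mod n = f x" if "x \<in> {0..m}" for x
    using that small by (simp add: cong_def)
  have "\<bar>F (x + 1) - F x\<bar> \<le> 1" if "x \<in> {0..<m}" for x
    using cycle_rel_step[OF n adj[of x "x + 1"]] that by (simp add: F_def sum_int_Suc)
  then have "lifts n m f F" using cong by (simp add: lifts_def F_def)
  moreover have "F m = n * winding n m f"
    using cong[of m] ends m by (auto simp: winding_def F_def mod_eq_0_iff_dvd)
  ultimately show ?thesis by (rule that)
qed


section \<open>Homotopy is equality of winding numbers\<close>

lemma homotopic_imp_winding_eq: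
  assumes n: "n \<ge> 4" and m: "0 \<le> m"
    and fg: "(f, g) \<in> homotopy (cycle_set n) (cycle_structure n) 0 m"
  shows "winding n m f = winding n m g"
proof -
  obtain H M N where MN: "M < N"
    and born: "bornologous ({0..m} \<times> (UNIV :: int set))
      (prod_structure (interval_structure m) line_structure) (cycle_set n) (cycle_structure n) H"
    and Hf: "\<forall>x\<in>{0..m}. \<forall>k\<le>M. H (x, k) = f x"
    and Hg: "\<forall>x\<in>{0..m}. \<forall>k\<ge>N. H (x, k) = g x"
    and ends: "\<forall>k. H (0, k) = 0 \<and> H (m, k) = 0"
    using fg unfolding homotopy_def mem_Collect_eq prod.case by (elim conjE exE) (rule that)
  define S where "S k x = (\<Sum>i\<in>{0..<x}. cycle_step n (H (i, k)) (H (i + 1, k)))" for k x :: int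
  have adj: "(H (a, k), H (b, l)) \<in> cycle_rel n"
    if "a \<in> {0..m}" "b \<in> {0..m}" "\<bar>a - b\<bar> \<le> 1" "\<bar>k - l\<bar> \<le> 1" for a b k l
    using born[unfolded bornologous_cycle_homotopy_iff, rule_format, of a b k l] that by simp
  have "cycle_step n 0 0 = 0" using cycle_step_mod[of n 0 0] n by simp
  \<comment> \<open>The lifts of two consecutive rows differ at \<open>x\<close> by the vertical
    step there; both rows start at the base point.\<close>
  have rows: "S (k + 1) x - S k x = cycle_step n (H (x, k)) (H (x, k + 1))"
    if "0 \<le> x" "x \<le> m" for x k
    using that
  proof (induction x rule: int_ge_induct)
    case base
    then show ?case using ends \<open>cycle_step n 0 0 = 0\<close> by (simp add: S_def)
  next
    case (step i)
    have i: "i \<in> {0..m}" "i + 1 \<in> {0..m}" using step.hyps step.prems by simp_all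
    have Suc: "S l (i + 1) = S l i + cycle_step n (H (i, l)) (H (i + 1, l))" for l
      unfolding S_def by (rule sum_int_Suc[OF step.hyps])
    \<comment> \<open>The diagonal cuts the unit square into two triangles, so both ways round the
      square have the same sum.\<close>
    have "cycle_step n (H (i, k)) (H (i, k + 1)) + cycle_step n (H (i, k + 1)) (H (i + 1, k + 1))
        = cycle_step n (H (i, k)) (H (i + 1, k + 1))"
      by (rule cycle_step_triangle[OF n]; rule adj) (use i in simp_all)
    moreover have "cycle_step n (H (i, k)) (H (i + 1, k))
        + cycle_step n (H (i + 1, k)) (H (i + 1, k + 1))
        = cycle_step n (H (i, k)) (H (i + 1, k + 1))"
      by (rule cycle_step_triangle[OF n]; rule adj) (use i in simp_all)
    moreover have "S (k + 1) i - S k i = cycle_step n (H (i, k)) (H (i, k + 1))"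
      using step.IH i by simp
    ultimately show ?case using Suc[of k] Suc[of "k + 1"] by linarith
  qed
  have const: "S (k + 1) m = S k m" for k
  proof -
    have "S (k + 1) m - S k m = cycle_step n (H (m, k)) (H (m, k + 1))"
      using m order_refl by (rule rows)
    also have "\<dots> = 0" by (simp only: ends \<open>cycle_step n 0 0 = 0\<close>)
    finally show ?thesis by linarith
  qed
  have "S k m = S M m" if "M \<le> k" for k
    using that
  proof (induction k rule: int_ge_induct)
    case (step i)
    have "S (i + 1) m = S i m" by (rule const)
    also have "\<dots> = S M m" by (rule step.IH)
    finally show ?case .
  qed (rule refl)
  then have "S N m = S M m" using MN less_imp_le by blast
  moreover have "S M m = (\<Sum>i\<in>{0..<m}. cycle_step n (f i) (f (i + 1)))"
    unfolding S_def by (rule sum.cong) (use Hf in simp_all)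
  moreover have "S N m = (\<Sum>i\<in>{0..<m}. cycle_step n (g i) (g (i + 1)))"
    unfolding S_def by (rule sum.cong) (use Hg in simp_all)
  ultimately show ?thesis by (simp add: winding_def)
qed

section \<open>Homotopies between lifts with the same end point\<close>

lemma max_min_nonexpansive:
  fixes a b c d :: int
  assumes "\<bar>a - c\<bar> \<le> 1" "\<bar>b - d\<bar> \<le> 1"
  shows "\<bar>max a b - max c d\<bar> \<le> 1" "\<bar>min a b - min c d\<bar> \<le> 1"
  using assms by (auto simp: max_def min_def abs_le_iff)

lemma winding_eq_imp_homotopic:
  assumes n: "n \<ge> 3" and m: "0 \<le> m"
    and f: "f \<in> cycle_loops n m" and g: "g \<in> cycle_loops n m"
    and eq: "winding n m f = winding n m g"
  shows "(f, g) \<in> homotopy (cycle_set n) (cycle_structure n) 0 m"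
proof -
  obtain F where F: "lifts n m f F" "F m = n * winding n m f"
    using loop_lifts[OF n m f] .
  obtain G where G: "lifts n m g G" "G m = n * winding n m g"
    using loop_lifts[OF n m g] .
  define B where "B = Max ((\<lambda>x. \<bar>F x\<bar>) ` {0..m} \<union> (\<lambda>x. \<bar>G x\<bar>) ` {0..m})"
  have B: "\<bar>F x\<bar> \<le> B" "\<bar>G x\<bar> \<le> B" if "x \<in> {0..m}" for x
    unfolding B_def using that by (auto intro!: Max_ge)
  have "0 \<le> B" using B(1)[of 0] m by simp
  \<comment> \<open>The first term is \<open>F x\<close> for \<open>k \<le> 2 * B\<close> and the
    second is \<open>G x\<close> for \<open>k \<ge> B\<close>. On the overlap \<open>K\<close> is
    the maximum of both lifts, so where \<open>F\<close> and \<open>G\<close> agree, as at both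
    ends, \<open>K\<close> keeps the common value at all times.\<close>
  define K where "K x k = max (min (F x) (3 * B - k)) (min (G x) k)" for x k
  define H where "H = (\<lambda>(x, k). K x k mod n)"
  have "\<bar>K b l - K a k\<bar> \<le> 1"
    if "a \<in> {0..m}" "b \<in> {0..m}" "\<bar>a - b\<bar> \<le> 1" "\<bar>k - l\<bar> \<le> 1" for a b k l
    using that lifts_lipschitz[OF F(1), of b a] lifts_lipschitz[OF G(1), of b a] unfolding K_def
    by (intro max_min_nonexpansive) (simp_all add: abs_minus_commute)
  then have "bornologous ({0..m} \<times> (UNIV :: int set))
      (prod_structure (interval_structure m) line_structure) (cycle_set n) (cycle_structure n) H"
    unfolding bornologous_cycle_homotopy_iff H_def by (simp add: mod_cycle_rel[OF n])
  moreover have "H (x, k) = f x" if "x \<in> {0..m}" "k \<le> - B" for x k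
  proof -
    have "K x k = F x" using B[OF that(1)] that(2) unfolding K_def by linarith
    then show ?thesis using F(1) that by (simp add: H_def lifts_def)
  qed
  \<comment> \<open>The summand 1 keeps the two times apart when \<open>B = 0\<close>.\<close>
  moreover have "H (x, k) = g x" if "x \<in> {0..m}" "k \<ge> 4 * B + 1" for x k
  proof -
    have "K x k = G x" using B[OF that(1)] that(2) unfolding K_def by linarith
    then show ?thesis using G(1) that by (simp add: H_def lifts_def)
  qed
  moreover have "H (0, k) = 0 \<and> H (m, k) = 0" for k
  proof -
    have "F 0 = 0" "G 0 = 0" using F(1) G(1) by (auto simp: lifts_def)
    then have "K 0 k = 0" using \<open>0 \<le> B\<close> unfolding K_def by linarith
    moreover have "F m = G m" using F(2) G(2) eq by simp
    then have "K m k = F m" using B[of m] m unfolding K_def by simp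
    ultimately show ?thesis using F(2) by (simp add: H_def)
  qed
  moreover have "- B < 4 * B + 1" using \<open>0 \<le> B\<close> by simp
  ultimately show ?thesis unfolding homotopy_def using f g by blast
qed

section \<open>The winding number of the cycle as an invariant\<close>

lemma loop_of_path:
  assumes "n \<ge> 3" "0 \<le> m" "f \<in> extensional {0..m}" "lifts n m f F" "F m = n * d"
  shows "f \<in> cycle_loops n m \<and> winding n m f = d"
  using lifts_imp_loop[of n f m F] winding_lifts[of n m f F] assms by simp

lemma winding_number_cycle:
  assumes n: "n \<ge> 4"
  shows "winding_number (cycle_set n) (cycle_structure n) 0 (winding n)"
proof
  have n3: "n \<ge> 3" using n by simp
  show "(f, g) \<in> homotopy (cycle_set n) (cycle_structure n) 0 m \<longleftrightarrow>
      f \<in> cycle_loops n m \<and> g \<in> cycle_loops n m \<and> winding n m f = winding n m g"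
    if m: "m \<ge> 1" for m f g
  proof -
    have "0 \<le> m" using m by simp
    moreover have "f \<in> cycle_loops n m \<and> g \<in> cycle_loops n m"
      if "(f, g) \<in> homotopy (cycle_set n) (cycle_structure n) 0 m"
      using that unfolding homotopy_def by blast
    ultimately show ?thesis
      using homotopic_imp_winding_eq[OF n] winding_eq_imp_homotopic[OF n3] by blast
  qed
  show "pad m m' f \<in> cycle_loops n m' \<and> winding n m' (pad m m' f) = winding n m f"
    if m: "1 \<le> m" "m \<le> m'" and f: "f \<in> cycle_loops n m" for m m' f
  proof -
    obtain F where F: "lifts n m f F" "F m = n * winding n m f"
      by (rule loop_lifts[OF n3 _ f]) (use m in simp)
    have "\<bar>F (min (x + 1) m) - F (min x m)\<bar> \<le> 1" if "x \<in> {0..<m'}" for x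
      using that m by (intro lifts_lipschitz[OF F(1)]) auto
    \<comment> \<open>The padded loop is lifted by stopping the lift at its end point.\<close>
    then have lifts: "lifts n m' (pad m m' f) (\<lambda>x. F (min x m))"
      using F(1) m by (simp add: lifts_def pad_def)
    show ?thesis
      by (rule loop_of_path[OF n3 _ _ lifts]) (use F(2) m in \<open>simp_all add: pad_def\<close>)
  qed
  show "loop_concat m m' f g \<in> cycle_loops n (m + m') \<and>
      winding n (m + m') (loop_concat m m' f g) = winding n m f + winding n m' g"
    if m: "1 \<le> m" "1 \<le> m'" and f: "f \<in> cycle_loops n m" and g: "g \<in> cycle_loops n m'"
    for m m' f g
  proof -
    obtain F where F: "lifts n m f F" "F m = n * winding n m f"
      by (rule loop_lifts[OF n3 _ f]) (use m in simp)
    obtain G where G: "lifts n m' g G" "G m' = n * winding n m' g"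
      by (rule loop_lifts[OF n3 _ g]) (use m in simp)
    \<comment> \<open>The second lift is translated to start where the first ends;
      \<open>F m\<close> is a multiple of \<open>n\<close>, so residues do not change.\<close>
    define E where "E x = (if x \<le> m then F x else F m + G (x - m))" for x
    have "\<bar>E (x + 1) - E x\<bar> \<le> 1" if x: "x \<in> {0..<m + m'}" for x
    proof (cases "x < m")
      case True
      then show ?thesis using F(1) x by (simp add: E_def lifts_def)
    next
      case False
      \<comment> \<open>At \<open>y = m\<close> the two branches agree because
        \<open>G 0 = 0\<close>.\<close>
      have E: "E y = F m + G (y - m)" if "y \<ge> m" for y
        using G(1) that unfolding E_def lifts_def by (cases "y = m") simp_all
      have "E (x + 1) - E x = G (x - m + 1) - G (x - m)"
        using E[of x] E[of "x + 1"] False by (simp add: algebra_simps)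
      moreover have "x - m \<in> {0..<m'}" using x False by simp
      then have "\<bar>G (x - m + 1) - G (x - m)\<bar> \<le> 1" using G(1) unfolding lifts_def by blast
      ultimately show ?thesis by simp
    qed
    moreover have "loop_concat m m' f g x = E x mod n" if "x \<in> {0..m + m'}" for x
    proof (cases "x \<le> m")
      case True
      then show ?thesis using that F(1) by (simp add: loop_concat_def E_def lifts_def)
    next
      case False
      then show ?thesis using that F(2) G(1) by (simp add: loop_concat_def E_def lifts_def)
    qed
    moreover have "E 0 = 0" using F(1) m by (simp add: E_def lifts_def)
    ultimately have lifts: "lifts n (m + m') (loop_concat m m' f g) E" unfolding lifts_def by blast
    have "E (m + m') = n * (winding n m f + winding n m' g)"
      using F(2) G(2) m by (simp add: E_def algebra_simps)
    with m show ?thesis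
      by (intro loop_of_path[OF n3 _ _ lifts]) (simp_all add: loop_concat_def)
  qed
  show "(\<lambda>x\<in>{0..1}. 0) \<in> cycle_loops n 1 \<and> winding n 1 (\<lambda>x\<in>{0..1}. 0) = 0"
    by (rule loop_of_path[OF n3, where F = "\<lambda>_. 0"]) (auto simp: lifts_def)
  show "\<exists>m f. 1 \<le> m \<and> f \<in> cycle_loops n m \<and> winding n m f = d" for d
  proof -
    \<comment> \<open>Long enough for \<open>\<bar>d\<bar>\<close> turns, with 1 added so that the
      length is positive also for \<open>d = 0\<close>.\<close>
    define m where "m = n * \<bar>d\<bar> + 1"
    have m: "1 \<le> m" using n by (simp add: m_def)
    \<comment> \<open>Unit steps in the direction of \<open>d\<close>, stopping after
      \<open>\<bar>d\<bar>\<close> turns.\<close>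
    define F where "F x = sgn d * min x (n * \<bar>d\<bar>)" for x
    have "F m = n * d" by (simp add: F_def m_def mult.left_commute sgn_mult_abs)
    have "\<bar>F (x + 1) - F x\<bar> \<le> 1" for x
      unfolding F_def by (cases d "0 :: int" rule: linorder_cases) (simp_all add: min_def)
    moreover have "F 0 = 0" using n by (simp add: F_def)
    ultimately have lifts: "lifts n m (\<lambda>x\<in>{0..m}. F x mod n) F" by (simp add: lifts_def)
    have "(\<lambda>x\<in>{0..m}. F x mod n) \<in> cycle_loops n m \<and> winding n m (\<lambda>x\<in>{0..m}. F x mod n) = d"
      using m by (intro loop_of_path[OF n3 _ _ lifts] \<open>F m = n * d\<close>) simp_all
    with m show ?thesis by blast
  qed
qed

theorem theorem3p4p9:
  fixes n :: int
  assumes "n \<ge> 4"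
  shows "group (pi1_sc (cycle_set n) (cycle_structure n) 0)
    \<and> pi1_sc (cycle_set n) (cycle_structure n) 0 \<cong> integer_group"
  using winding_number.group_pi1[OF winding_number_cycle[OF assms]]
    winding_number.pi1_iso_integers[OF winding_number_cycle[OF assms]] ..

end
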